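(* Let $\varphi\colon\Gamma\to G$ be a group homomorphism and let $\Gamma\xrightarrow{\psi}M\xrightarrow{n}G$ be a factorization of $\varphi$ (i.e. $\varphi=n\circ\psi$) such that $n\colon M\to G$ is a subnormal map. Then $\Gamma_{\infty,\varphi}\cong\Gamma_{\infty,\psi}$.
   Context: Composition is written right to left. A normal map (= crossed module) is a group homomorphism $n\colon M\to G$ together with a right action $m\mapsto m^g$ of $G$ on $M$ by automorphisms such that $n(m^g)=g^{-1}n(m)g$ and $m^{n(m')}=m'^{-1}mm'$ for all $m,m'\in M$, $g\in G$. Given normal maps $n\colon M\to G$ and $n'\colon M'\to G$, a normal morphism over $G$ is a homomorphism $\mu\colon M\to M'$ with $n'\circ\mu=n$ and $\mu(m^g)=\mu(m)^g$ for all $m\in M$, $g\in G$. A subnormal map $n\colon M\to G$ is a homomorphism such that there is a finite series of normal maps $n_i\colon M_{i+1}\to M_i$, $1\le i\le k$, with $M_1=G$ and $M_{k+1}=M$, whose composition $n_1\circ\cdots\circ n_k$ is $n$. The (free) normal closure of a homomorphism $\varphi\colon\Gamma\to G$ is the universal factorization $\Gamma\xrightarrow{c_\varphi}\Gamma^{\varphi}\xrightarrow{\overline{\varphi}}G$ of $\varphi$ with $\overline{\varphi}$ a normal map: for every factorization $\varphi=n\circ\psi$ with $\psi\colon\Gamma\to M$ a homomorphism and $n\colon M\to G$ a normal map there is a unique normal morphism $u\colon\Gamma^\varphi\to M$ over $G$ with $u\circ c_\varphi=\psi$. It exists and is unique up to unique isomorphism. The normal closures tower of $\varphi$ is defined by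 $\Gamma_1=\Gamma_{1,\varphi}=G$, $\varphi_1=\varphi$, and inductively $\Gamma_{i+1}=\Gamma_{i+1,\varphi}=\Gamma^{\varphi_i}$ (the normal closure of $\varphi_i\colon\Gamma\to\Gamma_i$), $\varphi_{i+1}=c_{\varphi_i}\colon\Gamma\to\Gamma_{i+1}$, with normal map $\overline{\varphi_i}\colon\Gamma_{i+1}\to\Gamma_i$. Then $\Gamma_{\infty,\varphi}=\varprojlim\Gamma_{i,\varphi}$ is the inverse limit of $\cdots\to\Gamma_3\to\Gamma_2\to\Gamma_1=G$. The group $\Gamma_{\infty,\psi}$ is defined in the same way for the homomorphism $\psi\colon\Gamma\to M$ (so its tower starts at $\Gamma_{1,\psi}=M$). *)

theory Defs
  imports "HOL-Algebra.Algebra" "HOL-Library.Infinite_Typeclass"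
begin

section \<open>Normal maps\<close>

text \<open>
  \<open>act m g\<close> is the right action usually written \<open>m\<^sup>g\<close>. Maps and actions are total functions
  whose values outside the carriers are irrelevant.
\<close>

locale normal_map = group_hom M G n
  for M :: "('m, 'c) monoid_scheme" (structure)
    and G :: "('g, 'd) monoid_scheme" (structure)
    and n :: "'m \<Rightarrow> 'g" +
  fixes act :: "'m \<Rightarrow> 'g \<Rightarrow> 'm"
  assumes act_automorphism: "g \<in> carrier G \<Longrightarrow> (\<lambda>m. act m g) \<in> iso M M"
    and act_one: "m \<in> carrier M \<Longrightarrow> act m \<one>\<^bsub>G\<^esub> = m"
    and act_mult: "\<lbrakk>m \<in> carrier M; g \<in> carrier G; h \<in> carrier G\<rbrakk>
          \<Longrightarrow> act m (g \<otimes>\<^bsub>G\<^esub> h) = act (act m g) h"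
    and equivariant: "\<lbrakk>m \<in> carrier M; g \<in> carrier G\<rbrakk>
          \<Longrightarrow> n (act m g) = inv\<^bsub>G\<^esub> g \<otimes>\<^bsub>G\<^esub> n m \<otimes>\<^bsub>G\<^esub> g"
    and peiffer: "\<lbrakk>m \<in> carrier M; m' \<in> carrier M\<rbrakk>
          \<Longrightarrow> act m (n m') = inv\<^bsub>M\<^esub> m' \<otimes>\<^bsub>M\<^esub> m \<otimes>\<^bsub>M\<^esub> m'"

text \<open>The morphism \<open>\<mu>\<close> goes from \<open>n :: M \<rightarrow> G\<close> to \<open>n' :: M' \<rightarrow> G\<close>, over the identity of \<open>G\<close>.\<close>

locale normal_morphism =
  source: normal_map M G n act + target: normal_map M' G n' act'
  for G :: "('g, 'd) monoid_scheme"
    and M :: "('m, 'c) monoid_scheme" and n and act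
    and M' :: "('k, 'e) monoid_scheme" and n' and act' +
  fixes \<mu> :: "'m \<Rightarrow> 'k"
  assumes hom: "\<mu> \<in> hom M M'"
    and over: "m \<in> carrier M \<Longrightarrow> n' (\<mu> m) = n m"
    and equivariant: "\<lbrakk>m \<in> carrier M; g \<in> carrier G\<rbrakk> \<Longrightarrow> \<mu> (act m g) = act' (\<mu> m) g"

text \<open>
  The series is \<open>M = S (k + 1) \<rightarrow> \<dots> \<rightarrow> S 1 = G\<close> and the \<open>foldr\<close> is \<open>ns 1 \<circ> \<dots> \<circ> ns k\<close>.
  For \<open>k = 0\<close> it gives the identity map, which is a normal map anyway.
\<close>

definition subnormal_map :: "'a monoid \<Rightarrow> 'a monoid \<Rightarrow> ('a \<Rightarrow> 'a) \<Rightarrow> bool" where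
  "subnormal_map M G n \<longleftrightarrow>
     group_hom M G n \<and>
     (\<exists>(k::nat) (S :: nat \<Rightarrow> 'a monoid) ns acts.
        S 1 = G \<and> S (k + 1) = M \<and>
        (\<forall>i\<in>{1..k}. normal_map (S (i + 1)) (S i) (ns i) (acts i)) \<and>
        (\<forall>m\<in>carrier M. n m = foldr (\<circ>) (map ns [1..<k + 1]) id m))"

section \<open>Normal closures\<close>

text \<open>
  The universal property quantifies over all groups, which is only possible relative to a type.
  The type \<open>'a\<close> plays the role of a universe: all groups are carried by subsets of \<open>'a\<close>.
  The class \<open>infinite\<close> makes this harmless. The free normal closure of a homomorphism
  \<open>\<Gamma> \<rightarrow> G\<close> is generated by the elements \<open>(c x)\<^sup>g\<close> with \<open>x \<in> \<Gamma>\<close>, \<open>g \<in> G\<close>, so over an infinite \<open>'a\<close>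
  it has an isomorphic copy on a subset of \<open>'a\<close>. Hence the closure exists in \<open>'a\<close>,
  and being universal among groups on \<open>'a\<close> is the same as being universal among all groups.
\<close>

locale free_normal_closure =
  phi: group_hom \<Gamma> G \<phi> + normal_map N G \<phi>bar act
  for \<Gamma> :: "'a::infinite monoid" and G :: "'a monoid" and \<phi> :: "'a \<Rightarrow> 'a"
    and N :: "'a monoid" and \<phi>bar :: "'a \<Rightarrow> 'a" and act :: "'a \<Rightarrow> 'a \<Rightarrow> 'a" +
  fixes c :: "'a \<Rightarrow> 'a"
  assumes c_hom: "c \<in> hom \<Gamma> N"
    and factorization: "x \<in> carrier \<Gamma> \<Longrightarrow> \<phi>bar (c x) = \<phi> x"
    and universal_ex: "\<lbrakk>normal_map (M :: 'a monoid) G n act'; \<psi> \<in> hom \<Gamma> M;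
            \<And>x. x \<in> carrier \<Gamma> \<Longrightarrow> \<phi> x = n (\<psi> x)\<rbrakk>
          \<Longrightarrow> \<exists>u. normal_morphism G N \<phi>bar act M n act' u \<and> (\<forall>x\<in>carrier \<Gamma>. u (c x) = \<psi> x)"
    and universal_unique: "\<lbrakk>normal_map (M :: 'a monoid) G n act'; \<psi> \<in> hom \<Gamma> M;
            \<And>x. x \<in> carrier \<Gamma> \<Longrightarrow> \<phi> x = n (\<psi> x);
            normal_morphism G N \<phi>bar act M n act' u; \<And>x. x \<in> carrier \<Gamma> \<Longrightarrow> u (c x) = \<psi> x;
            normal_morphism G N \<phi>bar act M n act' v; \<And>x. x \<in> carrier \<Gamma> \<Longrightarrow> v (c x) = \<psi> x;
            y \<in> carrier N\<rbrakk>
          \<Longrightarrow> u y = v y"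

text \<open>
  \<open>T i\<close>, \<open>f i\<close>, \<open>p i\<close> are \<open>\<Gamma>\<^sub>i\<close>, \<open>\<phi>\<^sub>i :: \<Gamma> \<rightarrow> \<Gamma>\<^sub>i\<close> and the normal map \<open>\<Gamma>\<^sub>i\<^sub>+\<^sub>1 \<rightarrow> \<Gamma>\<^sub>i\<close>, whose action
  is \<open>a i\<close>. Only indices \<open>i \<ge> 1\<close> matter. Since normal closures are defined up to unique isomorphism,
  this is a predicate on towers instead of a function of \<open>\<phi>\<close>.
\<close>

locale normal_closures_tower =
  phi: group_hom \<Gamma> G \<phi>
  for \<Gamma> :: "'a::infinite monoid" and G :: "'a monoid" and \<phi> :: "'a \<Rightarrow> 'a" +
  fixes T :: "nat \<Rightarrow> 'a monoid" and f :: "nat \<Rightarrow> 'a \<Rightarrow> 'a"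
    and p :: "nat \<Rightarrow> 'a \<Rightarrow> 'a" and a :: "nat \<Rightarrow> 'a \<Rightarrow> 'a \<Rightarrow> 'a"
  assumes T_1: "T 1 = G"
    and f_1: "f 1 = \<phi>"
    and closure: "i \<ge> 1 \<Longrightarrow>
          free_normal_closure \<Gamma> (T i) (f i) (T (i + 1)) (p i) (a i) (f (i + 1))"

definition inverse_limit :: "(nat \<Rightarrow> 'a monoid) \<Rightarrow> (nat \<Rightarrow> 'a \<Rightarrow> 'a) \<Rightarrow> (nat \<Rightarrow> 'a) monoid" where
  "inverse_limit T p =
     (product_group {1..} T)
       \<lparr>carrier := {x \<in> carrier (product_group {1..} T). \<forall>i\<ge>1. p i (x (i + 1)) = x i}\<rparr>"

end

theory Submission
  imports Defs
begin

text \<open>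
  The towers of \<open>\<phi>\<close> and of \<open>\<psi>\<close> can be interleaved, so they have the same inverse limit.

  Suppose first that \<open>n\<close> is normal. The universal property of \<open>\<Gamma>\<^sub>2\<^sub>,\<^sub>\<phi>\<close> gives a normal morphism
  \<open>\<Gamma>\<^sub>2\<^sub>,\<^sub>\<phi> \<rightarrow> M\<close> over \<open>G\<close>, and every normal morphism is itself a normal map
  (\<open>normal_morphism_imp_normal_map\<close>). Thus \<open>\<Gamma> \<rightarrow> \<Gamma>\<^sub>2\<^sub>,\<^sub>\<phi> \<rightarrow> M\<close> is again a factorization through a normal
  map, this time of \<open>\<psi>\<close>. The situation has reproduced itself with the two towers exchanged, and
  repeating the argument gives
  \<open>\<dots> \<rightarrow> \<Gamma>\<^sub>3\<^sub>,\<^sub>\<phi> \<rightarrow> \<Gamma>\<^sub>2\<^sub>,\<^sub>\<psi> \<rightarrow> \<Gamma>\<^sub>2\<^sub>,\<^sub>\<phi> \<rightarrow> M \<rightarrow> G\<close>, where two consecutive maps always compose to a map of one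
  of the towers.

  For a subnormal \<open>n\<close> the first step must go further up the tower. Let \<open>N \<rightarrow> M'\<close> be a normal map in a
  series for \<open>n\<close> and suppose that a compatible subnormal map \<open>\<Gamma>\<^sub>j \<rightarrow> M'\<close> is already known. Then the
  pullback \<open>P = N \<times>\<^bsub>M'\<^esub> \<Gamma>\<^sub>j\<close> is normal over \<open>\<Gamma>\<^sub>j\<close> and subnormal over \<open>N\<close> (\<open>subnormal_pullback\<close>). By the
  universal property of \<open>\<Gamma>\<^sub>j\<^sub>+\<^sub>1\<close> there is a normal map \<open>\<Gamma>\<^sub>j\<^sub>+\<^sub>1 \<rightarrow> P\<close>, so \<open>\<Gamma>\<^sub>j\<^sub>+\<^sub>1 \<rightarrow> P \<rightarrow> N\<close> is subnormal. This is
  \<open>lift_to_subnormal\<close>, the heart of the proof. Its conclusion again provides a subnormal map under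
  \<open>\<Gamma>\<close>, which makes the zigzag between the two towers possible.
  Each of its triangles commutes because the lifts are morphisms over the group below, and
  \<open>interleaved_inverse_limits_iso\<close> turns the zigzag into an isomorphism of limits.
\<close>

section \<open>Subnormal maps\<close>

text \<open>
  \<open>M'\<close> acts on \<open>M\<close> through \<open>n'\<close>. The Peiffer identity of the target becomes equivariance of \<open>\<mu>\<close>, and
  the Peiffer identity of the source remains what it was, because \<open>\<mu>\<close> lies over \<open>G\<close>.
\<close>

lemma normal_morphism_imp_normal_map:
  assumes "normal_morphism G M n act M' n' act' \<mu>"
  shows "normal_map M M' \<mu> (\<lambda>m m'. act m (n' m'))"
proof -
  interpret normal_morphism G M n act M' n' act' \<mu> by fact
  interpret \<mu>: group_hom M M' \<mu>
    by (unfold_locales) (rule hom)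
  show ?thesis
  proof
    fix g assume "g \<in> carrier M'"
    then show "(\<lambda>m. act m (n' g)) \<in> iso M M"
      by (simp add: source.act_automorphism)
  next
    fix m assume "m \<in> carrier M"
    then show "act m (n' \<one>\<^bsub>M'\<^esub>) = m"
      by (simp add: source.act_one)
  next
    fix m g h assume "m \<in> carrier M" "g \<in> carrier M'" "h \<in> carrier M'"
    then show "act m (n' (g \<otimes>\<^bsub>M'\<^esub> h)) = act (act m (n' g)) (n' h)"
      by (simp add: source.act_mult)
  next
    fix m g assume "m \<in> carrier M" "g \<in> carrier M'"
    then show "\<mu> (act m (n' g)) = inv\<^bsub>M'\<^esub> g \<otimes>\<^bsub>M'\<^esub> \<mu> m \<otimes>\<^bsub>M'\<^esub> g"
      by (simp add: equivariant target.peiffer)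
  next
    fix m m' assume "m \<in> carrier M" "m' \<in> carrier M"
    then show "act m (n' (\<mu> m')) = inv\<^bsub>M\<^esub> m' \<otimes>\<^bsub>M\<^esub> m \<otimes>\<^bsub>M\<^esub> m'"
      by (simp add: over source.peiffer)
  qed
qed

text \<open>
  An inductive form of subnormality, which removes the bookkeeping of the series from the inductions
  below. The series grows at the source, so the last normal map is always the one to be lifted along.
\<close>

inductive subnormal :: "'a monoid \<Rightarrow> 'a monoid \<Rightarrow> ('a \<Rightarrow> 'a) \<Rightarrow> bool" where
  subnormal_id: "group G \<Longrightarrow> subnormal G G id"
| subnormal_step: "subnormal M G n \<Longrightarrow> normal_map N M \<nu> act \<Longrightarrow> subnormal N G (n \<circ> \<nu>)"

lemma subnormal_imp_group_hom: "subnormal M G n \<Longrightarrow> group_hom M G n"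
proof (induction rule: subnormal.induct)
  case (subnormal_id G)
  then show ?case
    by (simp add: group_hom_def group_hom_axioms_def hom_def)
next
  case (subnormal_step M G n N \<nu> act)
  then show ?case
    by (auto simp: normal_map_def group_hom_def group_hom_axioms_def
        intro: Group.hom_compose[unfolded comp_def])
qed

lemma normal_imp_subnormal:
  assumes "normal_map N M \<nu> act"
  shows "subnormal N M \<nu>"
proof -
  have "group M"
    using assms by (simp add: normal_map_def group_hom_def)
  from subnormal_step[OF subnormal_id[OF this] assms] show ?thesis by simp
qed

text \<open>
  The map from stage \<open>j\<close> down to stage \<open>i\<close> of a sequence of maps \<open>p i\<close> from stage \<open>i + 1\<close> to
  stage \<open>i\<close>, for \<open>i \<le> j\<close>. It is a \<open>foldr\<close> in order to agree with \<open>subnormal_map\<close>.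
\<close>

definition composite :: "(nat \<Rightarrow> 'a \<Rightarrow> 'a) \<Rightarrow> nat \<Rightarrow> nat \<Rightarrow> 'a \<Rightarrow> 'a" where
  "composite p i j = foldr (\<circ>) (map p [i..<j]) id"

lemma foldr_comp_eq: "foldr (\<circ>) fs g = foldr (\<circ>) fs id \<circ> g"
  by (induction fs) (simp_all add: comp_assoc)

lemma composite_self [simp]: "composite p i i = id"
  by (simp add: composite_def)

lemma composite_trans:
  assumes "i \<le> j" "j \<le> k"
  shows "composite p i k = composite p i j \<circ> composite p j k"
proof -
  have "[i..<k] = [i..<j] @ [j..<k]"
    using assms by (metis le_add_diff_inverse upt_add_eq_append)
  then show ?thesis
    by (simp add: composite_def) (rule foldr_comp_eq)
qed

lemma composite_Suc_self [simp]: "composite p i (Suc i) = p i"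
  by (simp add: composite_def)

lemma composite_Suc: "i \<le> j \<Longrightarrow> composite p i (Suc j) = composite p i j \<circ> p j"
  using composite_trans[of i j "Suc j" p] by simp

text \<open>
  The map is replaced by the composite of its series, with which it agrees only on the carrier.
\<close>

lemma subnormal_map_imp_subnormal:
  assumes "subnormal_map M G n"
  obtains n' where "subnormal M G n'" and "\<And>m. m \<in> carrier M \<Longrightarrow> n m = n' m"
proof -
  from assms obtain k S ns acts
    where S: "S 1 = G" "S (k + 1) = M"
      and normal: "\<And>i. i \<in> {1..k} \<Longrightarrow> normal_map (S (i + 1)) (S i) (ns i) (acts i)"
      and n: "\<forall>m\<in>carrier M. n m = composite ns 1 (k + 1) m"
      and "group_hom M G n"
    unfolding subnormal_map_def composite_def by blast
  then have "group (S 1)"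
    by (simp add: group_hom_def)
  have "subnormal (S (l + 1)) (S 1) (composite ns 1 (l + 1))" if "l \<le> k" for l
    using that
  proof (induction l)
    case 0
    show ?case using subnormal_id[OF \<open>group (S 1)\<close>] by (simp add: id_def)
  next
    case (Suc l)
    have "subnormal (S (Suc l + 1)) (S 1) (composite ns 1 (l + 1) \<circ> ns (l + 1))"
      using subnormal_step[OF _ normal[of "l + 1"]] Suc by simp
    then show ?case
      using composite_Suc[of 1 "l + 1" ns] by (simp add: comp_def)
  qed
  from this[of k] show ?thesis
    using S n that by simp
qed

section \<open>Pullbacks\<close>

text \<open>
  Pullbacks are characterized up to isomorphism, not built as groups of pairs. Fibre products of
  groups on \<open>'a\<close> are needed on \<open>'a\<close> itself, and this form makes the two projections
  interchangeable and allows pasting squares without comparing different codings of pairs.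
\<close>

locale pullback = left: group_hom A C \<alpha> + right: group_hom B C \<beta>
  for A :: "'a monoid" and B :: "'a monoid" and C :: "'a monoid" and \<alpha> \<beta> +
  fixes P :: "'a monoid" and \<pi> \<rho>
  assumes P_group: "group P"
    and \<pi>_hom: "\<pi> \<in> hom P A"
    and \<rho>_hom: "\<rho> \<in> hom P B"
    and square: "z \<in> carrier P \<Longrightarrow> \<alpha> (\<pi> z) = \<beta> (\<rho> z)"
    and pairing: "\<lbrakk>x \<in> carrier A; y \<in> carrier B; \<alpha> x = \<beta> y\<rbrakk>
          \<Longrightarrow> \<exists>z\<in>carrier P. \<pi> z = x \<and> \<rho> z = y"
    and joint_inj: "\<lbrakk>z \<in> carrier P; w \<in> carrier P; \<pi> z = \<pi> w; \<rho> z = \<rho> w\<rbrakk> \<Longrightarrow> z = w"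
begin

sublocale P: group P by (rule P_group)
sublocale \<pi>: group_hom P A \<pi> by unfold_locales (rule \<pi>_hom)
sublocale \<rho>: group_hom P B \<rho> by unfold_locales (rule \<rho>_hom)

lemma swapped: "pullback B A C \<beta> \<alpha> P \<rho> \<pi>"
proof
  fix z assume "z \<in> carrier P"
  then show "\<beta> (\<rho> z) = \<alpha> (\<pi> z)" by (simp add: square)
next
  fix x y assume "x \<in> carrier B" "y \<in> carrier A" "\<beta> x = \<alpha> y"
  then show "\<exists>z\<in>carrier P. \<rho> z = x \<and> \<pi> z = y"
    using pairing[of y x] by auto
qed (auto intro: joint_inj)

lemma universal:
  assumes "g \<in> hom \<Gamma> A" and "h \<in> hom \<Gamma> B"
    and "\<And>x. x \<in> carrier \<Gamma> \<Longrightarrow> \<alpha> (g x) = \<beta> (h x)" and "group \<Gamma>"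
  obtains k where "k \<in> hom \<Gamma> P"
    and "\<And>x. x \<in> carrier \<Gamma> \<Longrightarrow> \<pi> (k x) = g x" and "\<And>x. x \<in> carrier \<Gamma> \<Longrightarrow> \<rho> (k x) = h x"
proof -
  interpret \<Gamma>: group \<Gamma> by fact
  have "\<forall>x\<in>carrier \<Gamma>. \<exists>z. z \<in> carrier P \<and> \<pi> z = g x \<and> \<rho> z = h x"
    using pairing assms(1-3) by (metis hom_in_carrier)
  then obtain k where k: "\<forall>x\<in>carrier \<Gamma>. k x \<in> carrier P \<and> \<pi> (k x) = g x \<and> \<rho> (k x) = h x"
    by metis
  have "k \<in> hom \<Gamma> P"
  proof (rule homI)
    fix x y assume "x \<in> carrier \<Gamma>" "y \<in> carrier \<Gamma>"
    then show "k (x \<otimes>\<^bsub>\<Gamma>\<^esub> y) = k x \<otimes>\<^bsub>P\<^esub> k y"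
      using k by - (rule joint_inj, auto simp: hom_mult[OF assms(1)] hom_mult[OF assms(2)])
  qed (use k in auto)
  then show ?thesis using that k by blast
qed

text \<open>
  Normal maps are stable under pullback: \<open>A\<close> acts on a pair by conjugation on the first
  component and through \<open>\<alpha>\<close> on the second. All identities are checked componentwise.
\<close>

lemma normal_projection:
  assumes "normal_map B C \<beta> act"
  obtains act' where "normal_map P A \<pi> act'"
proof -
  interpret b: normal_map B C \<beta> act by fact
  have act_closed: "act y c \<in> carrier B" if "y \<in> carrier B" "c \<in> carrier C" for y c
    using b.act_automorphism[OF that(2)] that(1) by (auto simp: iso_def hom_def)
  have act_hom: "act (y \<otimes>\<^bsub>B\<^esub> y') c = act y c \<otimes>\<^bsub>B\<^esub> act y' c"
    if "y \<in> carrier B" "y' \<in> carrier B" "c \<in> carrier C" for y y' c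
    using b.act_automorphism[OF that(3)] that(1,2) by (auto simp: iso_def hom_def)
  define q where "q z x = (SOME w. w \<in> carrier P
    \<and> \<pi> w = inv\<^bsub>A\<^esub> x \<otimes>\<^bsub>A\<^esub> \<pi> z \<otimes>\<^bsub>A\<^esub> x \<and> \<rho> w = act (\<rho> z) (\<alpha> x))" for z x
  have q: "q z x \<in> carrier P \<and> \<pi> (q z x) = inv\<^bsub>A\<^esub> x \<otimes>\<^bsub>A\<^esub> \<pi> z \<otimes>\<^bsub>A\<^esub> x
      \<and> \<rho> (q z x) = act (\<rho> z) (\<alpha> x)"
    if "z \<in> carrier P" "x \<in> carrier A" for z x
    unfolding q_def
  proof (rule someI_ex)
    show "\<exists>w. w \<in> carrier P \<and> \<pi> w = inv\<^bsub>A\<^esub> x \<otimes>\<^bsub>A\<^esub> \<pi> z \<otimes>\<^bsub>A\<^esub> x \<and> \<rho> w = act (\<rho> z) (\<alpha> x)"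
      using pairing[of "inv\<^bsub>A\<^esub> x \<otimes>\<^bsub>A\<^esub> \<pi> z \<otimes>\<^bsub>A\<^esub> x" "act (\<rho> z) (\<alpha> x)"] that
      by (auto simp: b.equivariant square act_closed)
  qed
  have conj_mult: "inv\<^bsub>A\<^esub> x \<otimes>\<^bsub>A\<^esub> (a \<otimes>\<^bsub>A\<^esub> b) \<otimes>\<^bsub>A\<^esub> x
      = inv\<^bsub>A\<^esub> x \<otimes>\<^bsub>A\<^esub> a \<otimes>\<^bsub>A\<^esub> x \<otimes>\<^bsub>A\<^esub> (inv\<^bsub>A\<^esub> x \<otimes>\<^bsub>A\<^esub> b \<otimes>\<^bsub>A\<^esub> x)"
    if "x \<in> carrier A" "a \<in> carrier A" "b \<in> carrier A" for x a b
  proof -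
    have "x \<otimes>\<^bsub>A\<^esub> (inv\<^bsub>A\<^esub> x \<otimes>\<^bsub>A\<^esub> (b \<otimes>\<^bsub>A\<^esub> x)) = b \<otimes>\<^bsub>A\<^esub> x"
      using that left.G.m_assoc[of x "inv\<^bsub>A\<^esub> x" "b \<otimes>\<^bsub>A\<^esub> x"] by simp
    with that show ?thesis by (simp add: left.G.m_assoc)
  qed
  have q_one: "q z \<one>\<^bsub>A\<^esub> = z" if "z \<in> carrier P" for z
    using that q[OF that, of "\<one>\<^bsub>A\<^esub>"] by - (rule joint_inj, auto simp: b.act_one)
  have q_mult: "q z (x \<otimes>\<^bsub>A\<^esub> y) = q (q z x) y"
    if "z \<in> carrier P" "x \<in> carrier A" "y \<in> carrier A" for z x y
    using that
    by - (rule joint_inj, auto simp: q b.act_mult left.G.inv_mult_group left.G.m_assoc)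
  have "normal_map P A \<pi> q"
  proof
    fix x assume x: "x \<in> carrier A"
    have "(\<lambda>z. q z x) \<in> hom P P"
    proof (rule homI)
      fix z w assume "z \<in> carrier P" "w \<in> carrier P"
      then show "q (z \<otimes>\<^bsub>P\<^esub> w) x = q z x \<otimes>\<^bsub>P\<^esub> q w x"
        using x
        by - (rule joint_inj, auto simp: q act_hom conj_mult)
    qed (use q x in auto)
    moreover have "bij_betw (\<lambda>z. q z x) (carrier P) (carrier P)"
      by (rule bij_betw_byWitness[where f' = "\<lambda>z. q z (inv\<^bsub>A\<^esub> x)"])
        (use q x q_mult[symmetric] q_one in auto)
    ultimately show "(\<lambda>z. q z x) \<in> iso P P"
      by (simp add: iso_def)
  next
    fix z w assume "z \<in> carrier P" "w \<in> carrier P"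
    then show "q z (\<pi> w) = inv\<^bsub>P\<^esub> w \<otimes>\<^bsub>P\<^esub> z \<otimes>\<^bsub>P\<^esub> w"
      by - (rule joint_inj, auto simp: q square b.peiffer)
  qed (use q q_one q_mult in auto)
  then show ?thesis using that by blast
qed

end

text \<open>
  With such a coding of pairs, fibre products of groups on \<open>'a\<close> exist on \<open>'a\<close> again and can be
  compared with the free normal closures, whose universal property speaks of groups on \<open>'a\<close>.
\<close>

lemma infinite_pairing:
  obtains e :: "'a::infinite \<times> 'a \<Rightarrow> 'a" where "inj_on e UNIV"
proof -
  have "\<not> finite (UNIV :: 'a set)"
    by (rule infinite_UNIV)
  from card_of_Times_same_infinite[OF this] show ?thesis
    using that unfolding card_of_ordIso[symmetric] by (auto simp: bij_betw_def)
qed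

lemma pullback_exists:
  fixes A B C :: "'a::infinite monoid"
  assumes "group_hom A C \<alpha>" and "group_hom B C \<beta>"
  obtains P \<pi> \<rho> where "pullback A B C \<alpha> \<beta> P \<pi> \<rho>"
proof -
  interpret left: group_hom A C \<alpha> by fact
  interpret right: group_hom B C \<beta> by fact
  obtain e :: "'a \<times> 'a \<Rightarrow> 'a" where "inj e" by (rule infinite_pairing)
  then have [simp]: "inv_into UNIV e (e z) = z" for z by simp
  define \<pi> where "\<pi> z = fst (inv_into UNIV e z)" for z
  define \<rho> where "\<rho> z = snd (inv_into UNIV e z)" for z
  have [simp]: "\<pi> (e (x, y)) = x" "\<rho> (e (x, y)) = y" for x y
    by (simp_all add: \<pi>_def \<rho>_def)
  define P :: "'a monoid" where "P =
    \<lparr>carrier = {e (x, y) | x y. x \<in> carrier A \<and> y \<in> carrier B \<and> \<alpha> x = \<beta> y},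
     monoid.mult = (\<lambda>z w. e (\<pi> z \<otimes>\<^bsub>A\<^esub> \<pi> w, \<rho> z \<otimes>\<^bsub>B\<^esub> \<rho> w)),
     monoid.one = e (\<one>\<^bsub>A\<^esub>, \<one>\<^bsub>B\<^esub>)\<rparr>"
  have in_P: "e (x, y) \<in> carrier P" if "x \<in> carrier A" "y \<in> carrier B" "\<alpha> x = \<beta> y" for x y
    using that by (auto simp: P_def)
  have P_cases: thesis
    if "z \<in> carrier P"
      and "\<And>x y. \<lbrakk>z = e (x, y); x \<in> carrier A; y \<in> carrier B; \<alpha> x = \<beta> y\<rbrakk> \<Longrightarrow> thesis"
    for z thesis
    using that by (auto simp: P_def)
  have P_mult: "e (x, y) \<otimes>\<^bsub>P\<^esub> e (x', y') = e (x \<otimes>\<^bsub>A\<^esub> x', y \<otimes>\<^bsub>B\<^esub> y')" for x y x' y'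
    by (simp add: P_def)
  have P_one: "\<one>\<^bsub>P\<^esub> = e (\<one>\<^bsub>A\<^esub>, \<one>\<^bsub>B\<^esub>)"
    by (simp add: P_def)
  have "group P"
  proof (rule groupI)
    fix z assume "z \<in> carrier P"
    then obtain x y where z: "z = e (x, y)" "x \<in> carrier A" "y \<in> carrier B" "\<alpha> x = \<beta> y"
      by (rule P_cases)
    then have "e (inv\<^bsub>A\<^esub> x, inv\<^bsub>B\<^esub> y) \<otimes>\<^bsub>P\<^esub> z = \<one>\<^bsub>P\<^esub>"
      by (simp add: P_mult P_one)
    moreover have "e (inv\<^bsub>A\<^esub> x, inv\<^bsub>B\<^esub> y) \<in> carrier P"
      using z by (simp add: in_P)
    ultimately show "\<exists>w\<in>carrier P. w \<otimes>\<^bsub>P\<^esub> z = \<one>\<^bsub>P\<^esub>"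
      by blast
  qed (auto simp: P_mult P_one left.G.m_assoc right.G.m_assoc intro!: in_P elim!: P_cases)
  moreover have "\<pi> \<in> hom P A" "\<rho> \<in> hom P B"
    by (auto simp: hom_def P_mult elim!: P_cases)
  moreover have "\<exists>z\<in>carrier P. \<pi> z = x \<and> \<rho> z = y"
    if "x \<in> carrier A" "y \<in> carrier B" "\<alpha> x = \<beta> y" for x y
    using in_P[OF that] by (intro bexI[of _ "e (x, y)"]) simp_all
  ultimately have "pullback A B C \<alpha> \<beta> P \<pi> \<rho>"
    unfolding pullback_def pullback_axioms_def
    using assms by (auto elim!: P_cases)
  then show ?thesis using that by blast
qed

lemma pullback_paste:
  assumes "pullback A Y C \<alpha> \<beta> Q \<pi> \<rho>" and "pullback Q B Y \<rho> \<nu> P \<sigma> \<tau>"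
  shows "pullback A B C \<alpha> (\<beta> \<circ> \<nu>) P (\<pi> \<circ> \<sigma>) \<tau>"
proof -
  interpret Q: pullback A Y C \<alpha> \<beta> Q \<pi> \<rho> by fact
  interpret P: pullback Q B Y \<rho> \<nu> P \<sigma> \<tau> by fact
  show ?thesis
  proof
    show "\<beta> \<circ> \<nu> \<in> hom B C"
      using Group.hom_compose P.right.homh Q.right.homh by blast
    show "\<pi> \<circ> \<sigma> \<in> hom P A"
      using Group.hom_compose P.\<pi>_hom Q.\<pi>_hom by blast
    fix x y assume *: "x \<in> carrier A" "y \<in> carrier B" "\<alpha> x = (\<beta> \<circ> \<nu>) y"
    then obtain z where z: "z \<in> carrier Q" "\<pi> z = x" "\<rho> z = \<nu> y"
      using Q.pairing[of x "\<nu> y"] by auto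
    then show "\<exists>w\<in>carrier P. (\<pi> \<circ> \<sigma>) w = x \<and> \<tau> w = y"
      using P.pairing[of z y] * by auto
  next
    fix z w assume *: "z \<in> carrier P" "w \<in> carrier P" "(\<pi> \<circ> \<sigma>) z = (\<pi> \<circ> \<sigma>) w" "\<tau> z = \<tau> w"
    then have "\<sigma> z = \<sigma> w"
      by - (rule Q.joint_inj, auto simp: P.square)
    with * show "z = w" by - (rule P.joint_inj, auto)
  qed (auto simp: Q.square P.square P.\<rho>_hom)
qed

text \<open>
  A subnormal map is pulled back one normal map at a time, pasting the squares.
\<close>

lemma subnormal_pullback:
  fixes A B C :: "'a::infinite monoid"
  assumes "subnormal B C \<beta>" and "group_hom A C \<alpha>"
  shows "\<exists>P \<pi> \<rho>. pullback A B C \<alpha> \<beta> P \<pi> \<rho> \<and> subnormal P A \<pi>"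
  using assms
proof (induction rule: subnormal.induct)
  case (subnormal_id C)
  then interpret group_hom A C \<alpha> by simp
  \<comment> \<open>The pullback of an identity map is \<open>A\<close> itself.\<close>
  have "pullback A C C \<alpha> id A id \<alpha>"
    by unfold_locales (auto simp: hom_def)
  then show ?case
    using subnormal.subnormal_id[OF G.is_group] by blast
next
  case (subnormal_step Y C \<beta> B \<nu> act)
  then obtain Q \<pi> \<rho> where Q: "pullback A Y C \<alpha> \<beta> Q \<pi> \<rho>" "subnormal Q A \<pi>"
    by blast
  interpret Q: pullback A Y C \<alpha> \<beta> Q \<pi> \<rho> by fact
  have "group_hom B Y \<nu>"
    using subnormal_step.hyps by (simp add: normal_map_def)
  then obtain P \<sigma> \<tau> where P: "pullback Q B Y \<rho> \<nu> P \<sigma> \<tau>"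
    by (rule pullback_exists[OF Q.\<rho>.group_hom_axioms])
  then obtain act' where "normal_map P Q \<sigma> act'"
    by (rule pullback.normal_projection[OF _ subnormal_step.hyps(2)])
  then have "subnormal P A (\<pi> \<circ> \<sigma>)"
    using Q(2) subnormal.subnormal_step by blast
  then show ?case
    using pullback_paste[OF Q(1) P] by blast
qed

section \<open>Normal closure towers dominate subnormal maps\<close>

context normal_closures_tower
begin

lemma closure_Suc: "i \<ge> 1 \<Longrightarrow> free_normal_closure \<Gamma> (T i) (f i) (T (Suc i)) (p i) (a i) (f (Suc i))"
  using closure by simp

lemma normal_p: "i \<ge> 1 \<Longrightarrow> normal_map (T (Suc i)) (T i) (p i) (a i)"
  using closure_Suc by (simp add: free_normal_closure_def)

lemma group_hom_f: "i \<ge> 1 \<Longrightarrow> group_hom \<Gamma> (T i) (f i)"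
  using closure_Suc by (simp add: free_normal_closure_def)

lemma p_f: "\<lbrakk>i \<ge> 1; x \<in> carrier \<Gamma>\<rbrakk> \<Longrightarrow> p i (f (Suc i) x) = f i x"
  using free_normal_closure.factorization[OF closure_Suc] .

text \<open>
  The lifting step. Each normal map of the series costs one stage of the tower; one further
  stage is spent at the start, so that \<open>j\<close> strictly exceeds \<open>i\<close> even for the empty series. This
  strictness makes the stages of the zigzag cofinal.
\<close>

lemma lift_to_subnormal:
  assumes "subnormal M G' n" and "G' = T i" and "i \<ge> 1"
    and "\<psi> \<in> hom \<Gamma> M" and "\<And>x. x \<in> carrier \<Gamma> \<Longrightarrow> n (\<psi> x) = f i x"
  shows "\<exists>j u. i < j \<and> subnormal (T j) M u
    \<and> (\<forall>t\<in>carrier (T j). n (u t) = composite p i j t) \<and> (\<forall>x\<in>carrier \<Gamma>. u (f j x) = \<psi> x)"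
  using assms
proof (induction arbitrary: \<psi> rule: subnormal.induct)
  case (subnormal_id G')
  then have "subnormal (T (Suc i)) G' (p i)"
    using normal_imp_subnormal normal_p by metis
  then show ?case
    using subnormal_id p_f by (intro exI[of _ "Suc i"] exI[of _ "p i"]) auto
next
  case (subnormal_step M G' n N \<nu> act)
  interpret \<nu>: normal_map N M \<nu> act by fact
  have "(\<lambda>x. \<nu> (\<psi> x)) \<in> hom \<Gamma> M"
    using Group.hom_compose[OF subnormal_step.prems(3) \<nu>.homh] by (simp add: comp_def)
  then obtain j u where "i < j" and u: "subnormal (T j) M u"
    and nu: "\<forall>t\<in>carrier (T j). n (u t) = composite p i j t"
    and uf: "\<forall>x\<in>carrier \<Gamma>. u (f j x) = \<nu> (\<psi> x)"
    using subnormal_step.IH[of "\<lambda>x. \<nu> (\<psi> x)"] subnormal_step.prems by auto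
  have "j \<ge> 1" using \<open>i < j\<close> by simp
  interpret f: group_hom \<Gamma> "T j" "f j" by (rule group_hom_f) fact
  obtain P \<pi> \<rho> where "pullback N (T j) M \<nu> u P \<pi> \<rho>" and \<pi>: "subnormal P N \<pi>"
    using subnormal_pullback[OF u \<nu>.group_hom_axioms] by blast
  then interpret P: pullback N "T j" M \<nu> u P \<pi> \<rho> by simp
  obtain b where \<rho>: "normal_map P (T j) \<rho> b"
    using pullback.normal_projection[OF P.swapped \<nu>.normal_map_axioms] by blast
  obtain k where k: "k \<in> hom \<Gamma> P"
    and \<pi>k: "\<And>x. x \<in> carrier \<Gamma> \<Longrightarrow> \<pi> (k x) = \<psi> x"
    and \<rho>k: "\<And>x. x \<in> carrier \<Gamma> \<Longrightarrow> \<rho> (k x) = f j x"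
    using P.universal[OF subnormal_step.prems(3) f.homh] uf phi.G.is_group by auto
  \<comment> \<open>\<open>\<Gamma>\<close> maps to the pullback, which is normal over stage \<open>j\<close>, so the closure of \<open>f j\<close> lifts to it.\<close>
  obtain w where w: "normal_morphism (T j) (T (Suc j)) (p j) (a j) P \<rho> b w"
    and wf: "\<forall>x\<in>carrier \<Gamma>. w (f (Suc j) x) = k x"
    using free_normal_closure.universal_ex[OF closure_Suc[OF \<open>j \<ge> 1\<close>] \<rho> k] \<rho>k by auto
  interpret w: normal_morphism "T j" "T (Suc j)" "p j" "a j" P \<rho> b w by fact
  have "subnormal (T (Suc j)) N (\<pi> \<circ> w)"
    using subnormal_step.hyps \<pi> normal_morphism_imp_normal_map[OF w] subnormal.subnormal_step
    by blast
  moreover have "(n \<circ> \<nu>) ((\<pi> \<circ> w) t) = composite p i (Suc j) t"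
    if t: "t \<in> carrier (T (Suc j))" for t
  proof -
    have "w t \<in> carrier P"
      using w.hom t by (simp add: hom_in_carrier)
    then have "(n \<circ> \<nu>) ((\<pi> \<circ> w) t) = n (u (p j t))"
      using P.square w.over[OF t] by simp
    also have "\<dots> = composite p i j (p j t)"
      using nu t w.source.hom_closed by blast
    finally show ?thesis
      using \<open>i < j\<close> by (simp add: composite_Suc)
  qed
  moreover have "(\<pi> \<circ> w) (f (Suc j) x) = \<psi> x" if "x \<in> carrier \<Gamma>" for x
    using that wf \<pi>k by simp
  ultimately show ?case
    using \<open>i < j\<close> less_SucI by blast
qed

end

section \<open>Inverse limits\<close>

locale inverse_system =
  fixes T :: "nat \<Rightarrow> 'a monoid" and p :: "nat \<Rightarrow> 'a \<Rightarrow> 'a"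
  assumes group_hom_p: "i \<ge> 1 \<Longrightarrow> group_hom (T (Suc i)) (T i) (p i)"
begin

abbreviation lim where "lim \<equiv> inverse_limit T p"

lemma lim_iff:
  "x \<in> carrier lim \<longleftrightarrow> x \<in> (\<Pi>\<^sub>E i\<in>{1..}. carrier (T i)) \<and> (\<forall>i\<ge>1. p i (x (Suc i)) = x i)"
  by (auto simp: inverse_limit_def)

lemma lim_carrier: "\<lbrakk>x \<in> carrier lim; i \<ge> 1\<rbrakk> \<Longrightarrow> x i \<in> carrier (T i)"
  by (auto simp: lim_iff)

lemma lim_mult: "i \<ge> 1 \<Longrightarrow> (x \<otimes>\<^bsub>lim\<^esub> y) i = x i \<otimes>\<^bsub>T i\<^esub> y i"
  by (simp add: inverse_limit_def)

lemma lim_mult_closed: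
  assumes x: "x \<in> carrier lim" and y: "y \<in> carrier lim"
  shows "x \<otimes>\<^bsub>lim\<^esub> y \<in> carrier lim"
proof -
  have "x i \<otimes>\<^bsub>T i\<^esub> y i \<in> carrier (T i)" if "i \<ge> 1" for i
    using x y lim_carrier[OF _ that] group_hom_p[OF that]
    by (simp add: group_hom_def group.is_monoid monoid.m_closed)
  moreover have "p i (x (Suc i) \<otimes>\<^bsub>T (Suc i)\<^esub> y (Suc i)) = x i \<otimes>\<^bsub>T i\<^esub> y i" if "i \<ge> 1" for i
  proof -
    have "x (Suc i) \<in> carrier (T (Suc i))" "y (Suc i) \<in> carrier (T (Suc i))"
      using x y lim_carrier by simp_all
    then show ?thesis
      using x y that group_hom.hom_mult[OF group_hom_p[OF that]] by (simp add: lim_iff)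
  qed
  ultimately show ?thesis
    by (auto simp: lim_iff lim_mult) (simp add: inverse_limit_def split: if_splits)
qed

lemma composite_closed:
  assumes "1 \<le> i" "i \<le> j" "x \<in> carrier (T j)"
  shows "composite p i j x \<in> carrier (T i)"
  using assms(2,3)
proof (induction j arbitrary: x rule: dec_induct)
  case (step j)
  then show ?case
    using assms(1) group_hom.hom_closed[OF group_hom_p[of j]] by (simp add: composite_Suc)
qed simp

lemma lim_coherent:
  assumes "x \<in> carrier lim" "1 \<le> i" "i \<le> j"
  shows "composite p i j (x j) = x i"
  using assms(3)
proof (induction j rule: dec_induct)
  case (step j)
  then show ?case
    using assms(1,2) by (simp add: composite_Suc lim_iff)
qed simp

lemma lim_eqI:
  fixes b :: "nat \<Rightarrow> nat"
  assumes "x \<in> carrier lim" "y \<in> carrier lim" "strict_mono b" "\<And>k. x (b k) = y (b k)"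
  shows "x = y"
proof
  fix i
  show "x i = y i"
  proof (cases "i \<ge> 1")
    case True
    have "i \<le> b i" using assms(3) by (rule strict_mono_imp_increasing)
    then show ?thesis
      using assms lim_coherent True by metis
  next
    case False
    then show ?thesis
      using assms(1,2) unfolding lim_iff by (metis PiE_arb atLeast_iff)
  qed
qed

text \<open>
  Together with \<open>lim_eqI\<close> this says that the limit can be computed along a cofinal set of stages.
\<close>

lemma lim_extend:
  assumes b: "strict_mono b" and "b 0 \<ge> 1"
    and z: "\<And>k. z k \<in> carrier (T (b k))"
    and coherent: "\<And>k. composite p (b k) (b (Suc k)) (z (Suc k)) = z k"
  obtains x where "x \<in> carrier lim" and "\<And>k. x (b k) = z k"
proof -
  have le_b: "k \<le> b k" for k using b by (rule strict_mono_imp_increasing)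
  have mono: "b k \<le> b l" if "k \<le> l" for k l
    using b that by (simp add: strict_mono_less_eq)
  have b_pos: "b k \<ge> 1" for k
    using mono[of 0 k] \<open>b 0 \<ge> 1\<close> by simp
  have indep: "composite p i (b l) (z l) = composite p i (b k) (z k)" if "i \<le> b k" "k \<le> l" for i k l
    using that(2)
  proof (induction l rule: dec_induct)
    case (step l)
    have "i \<le> b l"
      using that(1) mono[OF step.hyps(1)] by (rule le_trans)
    then have "composite p i (b (Suc l)) = composite p i (b l) \<circ> composite p (b l) (b (Suc l))"
      using mono[of l "Suc l"] by (intro composite_trans) simp_all
    then have "composite p i (b (Suc l)) (z (Suc l)) = composite p i (b l) (z l)"
      using coherent[of l] by (simp only: comp_apply)
    then show ?case using step.IH by (rule trans)
  qed (rule refl)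
  \<comment> \<open>Stage \<open>i\<close> is read off from \<open>z i\<close>, which lives at stage \<open>b i \<ge> i\<close>.\<close>
  define x where "x = (\<lambda>i\<in>{1..}. composite p i (b i) (z i))"
  have "p i (x (Suc i)) = x i" if "i \<ge> 1" for i
  proof -
    have "p i (x (Suc i)) = composite p i (b (Suc i)) (z (Suc i))"
      using composite_trans[of i "Suc i" "b (Suc i)" p] le_b[of "Suc i"] by (simp add: x_def)
    also have "\<dots> = x i"
      using indep[of i i "Suc i"] le_b that by (simp add: x_def)
    finally show ?thesis .
  qed
  moreover have "x i \<in> carrier (T i)" if "i \<ge> 1" for i
    using that z le_b by (simp add: x_def composite_closed)
  ultimately have "x \<in> carrier lim"
    by (auto simp: lim_iff) (simp add: x_def split: if_splits)
  moreover have "x (b k) = z k" for k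
    using indep[of "b k" k "b k"] le_b[of k] b_pos by (simp add: x_def)
  ultimately show ?thesis using that by blast
qed

end

text \<open>
  The maps \<open>u k\<close> induce a map of inverse limits. The maps \<open>v k\<close> recover \<open>x (a k)\<close> from
  \<open>u (Suc k) (x (a (Suc k)))\<close>, which gives injectivity, and provide the preimages.
\<close>

lemma interleaved_inverse_limits_iso:
  assumes "inverse_system T p" and "inverse_system T' p'"
    and a: "strict_mono a" "a 0 \<ge> 1" and b: "strict_mono b" "b 0 \<ge> 1"
    and u: "\<And>k. u k \<in> hom (T (a k)) (T' (b k))"
    and v: "\<And>k. v k \<in> hom (T' (b (Suc k))) (T (a k))"
    and uv: "\<And>k y. y \<in> carrier (T' (b (Suc k))) \<Longrightarrow> u k (v k y) = composite p' (b k) (b (Suc k)) y"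
    and vu: "\<And>k x. x \<in> carrier (T (a (Suc k))) \<Longrightarrow> v k (u (Suc k) x) = composite p (a k) (a (Suc k)) x"
  shows "inverse_limit T p \<cong> inverse_limit T' p'"
proof -
  interpret T: inverse_system T p by fact
  interpret T': inverse_system T' p' by fact
  have a_pos: "a k \<ge> 1" and b_pos: "b k \<ge> 1" for k
    using a b strict_mono_less_eq[of a 0 k] strict_mono_less_eq[of b 0 k] by auto
  have a_Suc: "a k \<le> a (Suc k)" and b_Suc: "b k \<le> b (Suc k)" for k
    using a b by (auto simp: strict_mono_less_eq)
  have xa: "x (a k) \<in> carrier (T (a k))" if "x \<in> carrier T.lim" for x k
    using that T.lim_carrier a_pos by blast
  have yb: "y (b k) \<in> carrier (T' (b k))" if "y \<in> carrier T'.lim" for y k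
    using that T'.lim_carrier b_pos by blast
  have v_u: "v k (u (Suc k) (x (a (Suc k)))) = x (a k)" if "x \<in> carrier T.lim" for x k
    using that vu xa T.lim_coherent a_pos a_Suc by simp
  have u_v: "u k (v k (y (b (Suc k)))) = y (b k)" if "y \<in> carrier T'.lim" for y k
    using that uv yb T'.lim_coherent b_pos b_Suc by simp
  have "\<exists>y\<in>carrier T'.lim. \<forall>k. y (b k) = u k (x (a k))" if x: "x \<in> carrier T.lim" for x
  proof (rule T'.lim_extend[OF b, of "\<lambda>k. u k (x (a k))"])
    fix k
    show "u k (x (a k)) \<in> carrier (T' (b k))" for k
      using hom_in_carrier[OF u xa[OF x]] .
    then show "composite p' (b k) (b (Suc k)) (u (Suc k) (x (a (Suc k)))) = u k (x (a k))"
      using uv v_u[OF x] by metis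
  qed blast
  then obtain F where F: "\<And>x. x \<in> carrier T.lim \<Longrightarrow> F x \<in> carrier T'.lim"
    and F_u: "\<And>x k. x \<in> carrier T.lim \<Longrightarrow> F x (b k) = u k (x (a k))"
    by metis
  have "F \<in> hom T.lim T'.lim"
  proof (rule homI)
    fix x y assume xy: "x \<in> carrier T.lim" "y \<in> carrier T.lim"
    show "F (x \<otimes>\<^bsub>T.lim\<^esub> y) = F x \<otimes>\<^bsub>T'.lim\<^esub> F y"
    proof (rule T'.lim_eqI[OF _ _ b(1)])
      fix k
      show "F (x \<otimes>\<^bsub>T.lim\<^esub> y) (b k) = (F x \<otimes>\<^bsub>T'.lim\<^esub> F y) (b k)"
        using xy xa a_pos b_pos
        by (simp add: F_u T.lim_mult T'.lim_mult T.lim_mult_closed hom_mult[OF u])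
    qed (use xy F T.lim_mult_closed T'.lim_mult_closed in auto)
  qed (rule F)
  moreover have "inj_on F (carrier T.lim)"
  proof (rule inj_onI)
    fix x y assume xy: "x \<in> carrier T.lim" "y \<in> carrier T.lim" "F x = F y"
    show "x = y"
    proof (rule T.lim_eqI[OF xy(1,2) a(1)])
      fix k show "x (a k) = y (a k)"
        using xy F_u v_u by metis
    qed
  qed
  moreover have "\<exists>x\<in>carrier T.lim. F x = y" if y: "y \<in> carrier T'.lim" for y
  proof (rule T.lim_extend[OF a, of "\<lambda>k. v k (y (b (Suc k)))"])
    fix k
    show "v k (y (b (Suc k))) \<in> carrier (T (a k))" for k
      using hom_in_carrier[OF v yb[OF y]] .
    then show "composite p (a k) (a (Suc k)) (v (Suc k) (y (b (Suc (Suc k))))) = v k (y (b (Suc k)))"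
      using vu u_v[OF y] by metis
  next
    fix x assume x: "x \<in> carrier T.lim" "\<And>k. x (a k) = v k (y (b (Suc k)))"
    then have "F x = y"
      by (intro T'.lim_eqI[OF F y b(1)]) (auto simp: F_u u_v[OF y])
    with x show ?thesis by blast
  qed
  ultimately have "F \<in> iso T.lim T'.lim"
    using F by (auto simp: iso_def bij_betw_def)
  then show ?thesis by (auto simp: is_iso_def)
qed

lemma (in normal_closures_tower) inverse_system: "inverse_system T p"
  using normal_p by (simp add: inverse_system_def normal_map_def)

section \<open>Interleaving the two towers\<close>

lemma subnormal_imp_iso_inverse_limits:
  assumes "normal_closures_tower \<Gamma> G \<phi> T f p a"
    and "normal_closures_tower \<Gamma> M \<psi> T' f' p' a'"
    and "subnormal M G n" and "\<And>x. x \<in> carrier \<Gamma> \<Longrightarrow> n (\<psi> x) = \<phi> x"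
  shows "inverse_limit T p \<cong> inverse_limit T' p'"
proof -
  interpret T: normal_closures_tower \<Gamma> G \<phi> T f p a by fact
  interpret T': normal_closures_tower \<Gamma> M \<psi> T' f' p' a' by fact
  \<comment> \<open>A state of the zigzag is a subnormal map from a stage of the first tower to one of the second,
    compatible with the maps from \<open>\<Gamma>\<close>. Lifting twice, first along \<open>u\<close> in the second tower and then along
    the resulting \<open>v\<close> in the first, leads to the next state. The choice of \<open>u'\<close> depends on \<open>v\<close> and thus
    on \<open>u\<close>, so the states are obtained by dependent choice.\<close>
  define under where "under = (\<lambda>(i, j, u). 1 \<le> i \<and> 1 \<le> j \<and> subnormal (T i) (T' j) u
    \<and> (\<forall>x\<in>carrier \<Gamma>. u (f i x) = f' j x))"
  define next_under where "next_under = (\<lambda>(i, j, u) (i', j', u'). i < i' \<and> j < j'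
    \<and> (\<exists>v. v \<in> hom (T' j') (T i) \<and> (\<forall>y\<in>carrier (T' j'). u (v y) = composite p' j j' y)
      \<and> (\<forall>x\<in>carrier (T i'). v (u' x) = composite p i i' x)))"
  have f: "f i \<in> hom \<Gamma> (T i)" and f': "f' i \<in> hom \<Gamma> (T' i)" if "i \<ge> 1" for i
    using T.group_hom_f[OF that] T'.group_hom_f[OF that] by (simp_all add: group_hom.homh)
  have "\<exists>s. under s"
  proof -
    obtain i u where "1 < i" "subnormal (T i) M u" "\<forall>x\<in>carrier \<Gamma>. u (f i x) = \<psi> x"
      using T.lift_to_subnormal[OF assms(3) T.T_1[symmetric], of \<psi>] assms(4) T'.phi.homh T.f_1
      by auto
    then have "under (i, 1, u)"
      by (simp add: under_def T'.T_1[simplified] T'.f_1[simplified])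
    then show ?thesis by blast
  qed
  moreover have "\<exists>s'. under s' \<and> next_under s s'" if "under s" for s
  proof -
    obtain i j u where s: "s = (i, j, u)" by (cases s)
    with that have ij: "1 \<le> i" "1 \<le> j" and u: "subnormal (T i) (T' j) u"
      and uf: "\<And>x. x \<in> carrier \<Gamma> \<Longrightarrow> u (f i x) = f' j x"
      by (auto simp: under_def)
    obtain j' v where j': "j < j'" and v: "subnormal (T' j') (T i) v"
      and uv: "\<forall>y\<in>carrier (T' j'). u (v y) = composite p' j j' y"
      and vf: "\<forall>x\<in>carrier \<Gamma>. v (f' j' x) = f i x"
      using T'.lift_to_subnormal[OF u refl ij(2) f[OF ij(1)] uf] by auto
    have "1 \<le> j'" using j' by simp
    obtain i' u' where i': "i < i'" and u': "subnormal (T i') (T' j') u'"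
      and vu: "\<forall>x\<in>carrier (T i'). v (u' x) = composite p i i' x"
      and uf': "\<forall>x\<in>carrier \<Gamma>. u' (f i' x) = f' j' x"
      using T.lift_to_subnormal[OF v refl ij(1) f'[OF \<open>1 \<le> j'\<close>]] vf by auto
    have "v \<in> hom (T' j') (T i)"
      using subnormal_imp_group_hom[OF v] by (simp add: group_hom.homh)
    then have "under (i', j', u') \<and> next_under s (i', j', u')"
      using i' j' u' uf' uv vu by (auto simp: s under_def next_under_def)
    then show ?thesis by blast
  qed
  ultimately obtain s where s: "\<And>k. under (s k)" "\<And>k. next_under (s k) (s (Suc k))"
    using dependent_nat_choice[of "\<lambda>_. under" "\<lambda>_. next_under"] by metis
  define i where "i k = fst (s k)" for k
  define j where "j k = fst (snd (s k))" for k
  define u where "u k = snd (snd (s k))" for k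
  have s_eq: "s k = (i k, j k, u k)" for k
    by (simp add: i_def j_def u_def)
  have "strict_mono i" "strict_mono j"
    using s(2) by (auto simp: s_eq next_under_def strict_mono_Suc_iff)
  moreover have "1 \<le> i 0" "1 \<le> j 0"
    using s(1)[of 0] by (auto simp: s_eq under_def)
  moreover have "u k \<in> hom (T (i k)) (T' (j k))" for k
    using s(1)[of k] subnormal_imp_group_hom[of "T (i k)" "T' (j k)" "u k"]
    by (simp add: s_eq under_def group_hom.homh)
  moreover have "\<exists>v. \<forall>k. v k \<in> hom (T' (j (Suc k))) (T (i k))
    \<and> (\<forall>y\<in>carrier (T' (j (Suc k))). u k (v k y) = composite p' (j k) (j (Suc k)) y)
    \<and> (\<forall>x\<in>carrier (T (i (Suc k))). v k (u (Suc k) x) = composite p (i k) (i (Suc k)) x)"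
    using s(2) unfolding s_eq next_under_def prod.case by (intro choice) blast
  then obtain v where "\<And>k. v k \<in> hom (T' (j (Suc k))) (T (i k))"
    "\<And>k y. y \<in> carrier (T' (j (Suc k))) \<Longrightarrow> u k (v k y) = composite p' (j k) (j (Suc k)) y"
    "\<And>k x. x \<in> carrier (T (i (Suc k))) \<Longrightarrow> v k (u (Suc k) x) = composite p (i k) (i (Suc k)) x"
    by blast
  ultimately show ?thesis
    using interleaved_inverse_limits_iso[OF T.inverse_system T'.inverse_system, of i j u v] by blast
qed

theorem theorem6:
  fixes \<Gamma> G M :: "'a::infinite monoid"
    and \<phi> \<psi> n :: "'a \<Rightarrow> 'a"
    and T T' :: "nat \<Rightarrow> 'a monoid"
    and f f' p p' :: "nat \<Rightarrow> 'a \<Rightarrow> 'a"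
    and a a' :: "nat \<Rightarrow> 'a \<Rightarrow> 'a \<Rightarrow> 'a"
  assumes "group_hom \<Gamma> G \<phi>"
    and "group_hom \<Gamma> M \<psi>"
    and "subnormal_map M G n"
    and "\<And>x. x \<in> carrier \<Gamma> \<Longrightarrow> \<phi> x = n (\<psi> x)"
    and "normal_closures_tower \<Gamma> G \<phi> T f p a"
    and "normal_closures_tower \<Gamma> M \<psi> T' f' p' a'"
  shows "inverse_limit T p \<cong> inverse_limit T' p'"
proof -
  obtain n' where n': "subnormal M G n'" "\<And>m. m \<in> carrier M \<Longrightarrow> n m = n' m"
    using subnormal_map_imp_subnormal[OF assms(3)] by blast
  have "n' (\<psi> x) = \<phi> x" if "x \<in> carrier \<Gamma>" for x
    using that n'(2) assms(4) group_hom.hom_closed[OF assms(2)] by metis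
  then show ?thesis
    using subnormal_imp_iso_inverse_limits[OF assms(5,6) n'(1)] by blast
qed

end
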